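(* Let $M(\phi,\xi,\eta,g_M)$ be a Sasakian manifold, $(N,g_N)$ a Riemannian manifold, and $F:M(\phi,\xi,\eta,g_M)\to(N,g_N)$ an anti-invariant Riemannian submersion such that the characteristic vector field $\xi$ is vertical and $\phi(\ker F_* )\neq\{0\}$. Then $F$ is not a totally geodesic map, i.e. $\nabla F_*$ does not vanish identically.
   Context: A Sasakian manifold $M(\phi,\xi,\eta,g_M)$ is a smooth manifold with a $(1,1)$-tensor field $\phi$, a vector field $\xi$ (the characteristic vector field), a 1-form $\eta$ and a Riemannian metric $g_M$ such that $\phi^2=-I+\eta\otimes\xi$, $\phi\xi=0$, $\eta\circ\phi=0$, $\eta(\xi)=1$, $g_M(\phi X,\phi Y)=g_M(X,Y)-\eta(X)\eta(Y)$, $\eta(X)=g_M(X,\xi)$, and $(\nabla_X\phi)Y=g_M(X,Y)\xi-\eta(Y)X$, where $\nabla$ is the Levi-Civita connection of $g_M$ (so that $\nabla_X\xi=-\phi X$). A Riemannian submersion $F:(M,g_M)\to(N,g_N)$ is a smooth surjective map of maximal rank whose differential $F_*$ preserves lengths of horizontal vectors. Vertical means tangent to $\ker F_*$; horizontal means tangent to the orthogonal complement $(\ker F_* )^\perp$. $F$ is anti-invariant if $\phi(\ker F_* )\subseteq(\ker F_* )^\perp$. The second fundamental form of $F$ is $(\nabla F_* )(X,Y)=\nabla^F_X F_*(Y)-F_*(\nabla_XY)$, where $\nabla^F$ is the pullback connection; $F$ is called totally geodesic if $\nabla F_*=0$. *)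

theory Defs
  imports "HOL-Analysis.Analysis" "HOL-Library.Function_Algebras"
begin

text \<open>Real functions form a real vector space under pointwise operations. Tangent vectors are
  functionals on real functions, so this gives their linear structure.\<close>

instantiation "fun" :: (type, real_vector) real_vector
begin

definition scaleR_fun :: "real \<Rightarrow> ('a \<Rightarrow> 'b) \<Rightarrow> 'a \<Rightarrow> 'b" where
  "scaleR_fun c f = (\<lambda>x. c *\<^sub>R f x)"

instance
  by standard (simp_all add: scaleR_fun_def plus_fun_def fun_eq_iff algebra_simps)

end

definition linear_on_subspace :: "'v::real_vector set \<Rightarrow> ('v \<Rightarrow> 'w::real_vector) \<Rightarrow> bool" where
  "linear_on_subspace S f \<longleftrightarrow>
     (\<forall>u\<in>S. \<forall>v\<in>S. f (u + v) = f u + f v) \<and> (\<forall>c. \<forall>v\<in>S. f (c *\<^sub>R v) = c *\<^sub>R f v)"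

text \<open>Used only on open sets of a finite-dimensional space, where this is the usual
  \<open>C\<close>-\<open>k\<close> condition.\<close>

primrec Ck_on :: "nat \<Rightarrow> 'e::real_normed_vector set \<Rightarrow> ('e \<Rightarrow> 'f::real_normed_vector) \<Rightarrow> bool" where
  "Ck_on 0 S f \<longleftrightarrow> continuous_on S f"
| "Ck_on (Suc k) S f \<longleftrightarrow>
     (\<forall>x\<in>S. f differentiable (at x)) \<and> (\<forall>v. Ck_on k S (\<lambda>x. frechet_derivative f (at x) v))"

definition smooth_on :: "'e::real_normed_vector set \<Rightarrow> ('e \<Rightarrow> 'f::real_normed_vector) \<Rightarrow> bool" where
  "smooth_on S f \<longleftrightarrow> (\<forall>k. Ck_on k S f)"

text \<open>A chart is a pair of its domain and its coordinate map; the values of the coordinate map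
  outside the domain are irrelevant. The underlying set of a manifold is a whole type.\<close>

type_synonym ('a, 'e) atlas = "('a set \<times> ('a \<Rightarrow> 'e)) set"

definition smooth_atlas :: "('a::topological_space, 'e::real_normed_vector) atlas \<Rightarrow> bool" where
  "smooth_atlas A \<longleftrightarrow>
     (\<Union>(U, \<kappa>)\<in>A. U) = UNIV \<and>
     (\<forall>(U, \<kappa>)\<in>A. open U \<and> open (\<kappa> ` U) \<and> homeomorphism U (\<kappa> ` U) \<kappa> (inv_into U \<kappa>)) \<and>
     (\<forall>(U, \<kappa>)\<in>A. \<forall>(V, \<mu>)\<in>A. smooth_on (\<kappa> ` (U \<inter> V)) (\<mu> \<circ> inv_into U \<kappa>))"

text \<open>The model space is a finite-dimensional normed space rather than a type of class
  \<open>euclidean_space\<close>, because the latter class excludes dimension 0.\<close>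

definition smooth_manifold ::
    "('a::{t2_space, second_countable_topology}, 'e::real_normed_vector) atlas \<Rightarrow> bool" where
  "smooth_manifold A \<longleftrightarrow> (\<exists>b::'e set. finite b \<and> span b = UNIV) \<and> smooth_atlas A"

definition smooth_fun :: "('a, 'e::real_normed_vector) atlas \<Rightarrow> ('a \<Rightarrow> real) \<Rightarrow> bool" where
  "smooth_fun A f \<longleftrightarrow> (\<forall>(U, \<kappa>)\<in>A. smooth_on (\<kappa> ` U) (f \<circ> inv_into U \<kappa>))"

definition smooth_map ::
    "('a::topological_space, 'e::real_normed_vector) atlas \<Rightarrow>
     ('b::topological_space, 'f::real_normed_vector) atlas \<Rightarrow> ('a \<Rightarrow> 'b) \<Rightarrow> bool" where
  "smooth_map A B F \<longleftrightarrow> continuous_on UNIV F \<and>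
     (\<forall>(U, \<kappa>)\<in>A. \<forall>(V, \<mu>)\<in>B. smooth_on (\<kappa> ` (U \<inter> F -` V)) (\<mu> \<circ> F \<circ> inv_into U \<kappa>))"

type_synonym 'a tangent = "('a \<Rightarrow> real) \<Rightarrow> real"
type_synonym 'a field = "'a \<Rightarrow> 'a tangent"

text \<open>Tangent vectors at \<open>p\<close> are the derivations at \<open>p\<close> of the algebra of smooth functions. They
  are set to 0 on non-smooth functions so that equality of tangent vectors is equality in HOL.\<close>

definition tangent_space :: "('a, 'e::real_normed_vector) atlas \<Rightarrow> 'a \<Rightarrow> 'a tangent set" where
  "tangent_space A p = {v.
     linear_on_subspace {f. smooth_fun A f} v \<and>
     (\<forall>f h. smooth_fun A f \<longrightarrow> smooth_fun A h \<longrightarrow> v (\<lambda>q. f q * h q) = v f * h p + f p * v h) \<and>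
     (\<forall>f. \<not> smooth_fun A f \<longrightarrow> v f = 0)}"

definition differential ::
    "('b, 'f::real_normed_vector) atlas \<Rightarrow> ('a \<Rightarrow> 'b) \<Rightarrow> 'a tangent \<Rightarrow> 'b tangent" where
  "differential B F v = (\<lambda>h. if smooth_fun B h then v (h \<circ> F) else 0)"

text \<open>Smooth sections of the pullback bundle \<open>F\<^sup>*TN\<close>, that is, smooth vector fields along \<open>F\<close>.\<close>

definition sections_along ::
    "('a, 'e::real_normed_vector) atlas \<Rightarrow> ('b, 'f::real_normed_vector) atlas \<Rightarrow> ('a \<Rightarrow> 'b) \<Rightarrow>
     ('a \<Rightarrow> 'b tangent) set" where
  "sections_along A B F = {s.
     (\<forall>p. s p \<in> tangent_space B (F p)) \<and> (\<forall>h. smooth_fun B h \<longrightarrow> smooth_fun A (\<lambda>p. s p h))}"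

definition vector_fields :: "('a, 'e::real_normed_vector) atlas \<Rightarrow> 'a field set" where
  "vector_fields A = sections_along A A id"

definition lie_bracket :: "'a field \<Rightarrow> 'a field \<Rightarrow> 'a field" where
  "lie_bracket X Y p = (\<lambda>f. X p (\<lambda>q. Y q f) - Y p (\<lambda>q. X q f))"

definition one_form ::
    "('a, 'e::real_normed_vector) atlas \<Rightarrow> ('a \<Rightarrow> 'a tangent \<Rightarrow> real) \<Rightarrow> bool" where
  "one_form A \<eta> \<longleftrightarrow>
     (\<forall>p. linear_on_subspace (tangent_space A p) (\<eta> p)) \<and>
     (\<forall>X\<in>vector_fields A. smooth_fun A (\<lambda>p. \<eta> p (X p)))"

definition tensor_field_1_1 ::
    "('a, 'e::real_normed_vector) atlas \<Rightarrow> ('a \<Rightarrow> 'a tangent \<Rightarrow> 'a tangent) \<Rightarrow> bool" where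
  "tensor_field_1_1 A \<phi> \<longleftrightarrow>
     (\<forall>p. linear_on_subspace (tangent_space A p) (\<phi> p) \<and>
          \<phi> p ` tangent_space A p \<subseteq> tangent_space A p) \<and>
     (\<forall>X\<in>vector_fields A. (\<lambda>p. \<phi> p (X p)) \<in> vector_fields A)"

type_synonym 'a metric = "'a \<Rightarrow> 'a tangent \<Rightarrow> 'a tangent \<Rightarrow> real"

definition riemannian_metric :: "('a, 'e::real_normed_vector) atlas \<Rightarrow> 'a metric \<Rightarrow> bool" where
  "riemannian_metric A g \<longleftrightarrow>
     (\<forall>p. \<forall>u\<in>tangent_space A p.
        linear_on_subspace (tangent_space A p) (g p u) \<and>
        (\<forall>v\<in>tangent_space A p. g p u v = g p v u) \<and>
        (u \<noteq> 0 \<longrightarrow> g p u u > 0)) \<and>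
     (\<forall>X\<in>vector_fields A. \<forall>Y\<in>vector_fields A. smooth_fun A (\<lambda>p. g p (X p) (Y p)))"

definition riemannian_manifold ::
    "('a::{t2_space, second_countable_topology}, 'e::real_normed_vector) atlas \<Rightarrow>
     'a metric \<Rightarrow> bool" where
  "riemannian_manifold A g \<longleftrightarrow> smooth_manifold A \<and> riemannian_metric A g"

text \<open>A connection on \<open>F\<^sup>*TN\<close>: \<open>D p v s\<close> is the covariant derivative of the section \<open>s\<close> in the
  direction of the tangent vector \<open>v\<close> at \<open>p\<close>. Being tensorial in the first argument, a connection
  is given on tangent vectors there; the value on vector fields is \<open>\<lambda>p. D p (X p) s\<close>. For
  \<open>F = id\<close> this is an affine connection. Nothing is required of \<open>D p v s\<close> unless \<open>v\<close> is tangent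
  at \<open>p\<close> and \<open>s\<close> is a smooth section.\<close>

definition connection_along ::
    "('a, 'e::real_normed_vector) atlas \<Rightarrow> ('b, 'f::real_normed_vector) atlas \<Rightarrow> ('a \<Rightarrow> 'b) \<Rightarrow>
     ('a \<Rightarrow> 'a tangent \<Rightarrow> ('a \<Rightarrow> 'b tangent) \<Rightarrow> 'b tangent) \<Rightarrow> bool" where
  "connection_along A B F D \<longleftrightarrow>
     (\<forall>s\<in>sections_along A B F. \<forall>p. linear_on_subspace (tangent_space A p) (\<lambda>v. D p v s)) \<and>
     (\<forall>s\<in>sections_along A B F. \<forall>p. \<forall>v\<in>tangent_space A p. D p v s \<in> tangent_space B (F p)) \<and>
     (\<forall>s\<in>sections_along A B F. \<forall>X\<in>vector_fields A.
        (\<lambda>p. D p (X p) s) \<in> sections_along A B F) \<and>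
     (\<forall>s\<in>sections_along A B F. \<forall>t\<in>sections_along A B F. \<forall>p. \<forall>v\<in>tangent_space A p.
        D p v (\<lambda>q. s q + t q) = D p v s + D p v t) \<and>
     (\<forall>s\<in>sections_along A B F. \<forall>f. smooth_fun A f \<longrightarrow> (\<forall>p. \<forall>v\<in>tangent_space A p.
        D p v (\<lambda>q. f q *\<^sub>R s q) = v f *\<^sub>R s p + f p *\<^sub>R D p v s))"

type_synonym 'a connection = "'a \<Rightarrow> 'a tangent \<Rightarrow> 'a field \<Rightarrow> 'a tangent"

definition levi_civita ::
    "('a, 'e::real_normed_vector) atlas \<Rightarrow> 'a metric \<Rightarrow> 'a connection \<Rightarrow> bool" where
  "levi_civita A g D \<longleftrightarrow>
     connection_along A A id D \<and>
     (\<forall>X\<in>vector_fields A. \<forall>Y\<in>vector_fields A. \<forall>p.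
        D p (X p) Y - D p (Y p) X = lie_bracket X Y p) \<and>
     (\<forall>Y\<in>vector_fields A. \<forall>Z\<in>vector_fields A. \<forall>p. \<forall>v\<in>tangent_space A p.
        v (\<lambda>q. g q (Y q) (Z q)) = g p (D p v Y) (Z p) + g p (Y p) (D p v Z))"

text \<open>The pullback of a connection \<open>DN\<close> on \<open>N\<close> is the unique connection on \<open>F\<^sup>*TN\<close> that satisfies
  the chain rule on sections of the form \<open>Z \<circ> F\<close>.\<close>

definition pullback_connection ::
    "('a, 'e::real_normed_vector) atlas \<Rightarrow> ('b, 'f::real_normed_vector) atlas \<Rightarrow> ('a \<Rightarrow> 'b) \<Rightarrow>
     'b connection \<Rightarrow> ('a \<Rightarrow> 'a tangent \<Rightarrow> ('a \<Rightarrow> 'b tangent) \<Rightarrow> 'b tangent) \<Rightarrow> bool" where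
  "pullback_connection A B F DN DF \<longleftrightarrow>
     connection_along A B F DF \<and>
     (\<forall>Z\<in>vector_fields B. \<forall>p. \<forall>v\<in>tangent_space A p.
        DF p v (\<lambda>q. Z (F q)) = DN (F p) (differential B F v) Z)"

definition sasakian_manifold ::
    "('a::{t2_space, second_countable_topology}, 'e::real_normed_vector) atlas \<Rightarrow>
     ('a \<Rightarrow> 'a tangent \<Rightarrow> 'a tangent) \<Rightarrow> 'a field \<Rightarrow> ('a \<Rightarrow> 'a tangent \<Rightarrow> real) \<Rightarrow> 'a metric \<Rightarrow>
     'a connection \<Rightarrow> bool" where
  "sasakian_manifold A \<phi> \<xi> \<eta> g D \<longleftrightarrow>
     riemannian_manifold A g \<and> levi_civita A g D \<and>
     tensor_field_1_1 A \<phi> \<and> \<xi> \<in> vector_fields A \<and> one_form A \<eta> \<and>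
     (\<forall>p. \<forall>v\<in>tangent_space A p. \<phi> p (\<phi> p v) = - v + \<eta> p v *\<^sub>R \<xi> p) \<and>
     (\<forall>p. \<phi> p (\<xi> p) = 0) \<and>
     (\<forall>p. \<forall>v\<in>tangent_space A p. \<eta> p (\<phi> p v) = 0) \<and>
     (\<forall>p. \<eta> p (\<xi> p) = 1) \<and>
     (\<forall>p. \<forall>u\<in>tangent_space A p. \<forall>v\<in>tangent_space A p.
        g p (\<phi> p u) (\<phi> p v) = g p u v - \<eta> p u * \<eta> p v) \<and>
     (\<forall>p. \<forall>v\<in>tangent_space A p. \<eta> p v = g p v (\<xi> p)) \<and>
     (\<forall>p. \<forall>v\<in>tangent_space A p. \<forall>Y\<in>vector_fields A.
        D p v (\<lambda>q. \<phi> q (Y q)) - \<phi> p (D p v Y) = g p v (Y p) *\<^sub>R \<xi> p - \<eta> p (Y p) *\<^sub>R v)"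

definition vertical_space ::
    "('a, 'e::real_normed_vector) atlas \<Rightarrow> ('b, 'f::real_normed_vector) atlas \<Rightarrow> ('a \<Rightarrow> 'b) \<Rightarrow>
     'a \<Rightarrow> 'a tangent set" where
  "vertical_space A B F p = {v \<in> tangent_space A p. differential B F v = 0}"

definition horizontal_space ::
    "('a, 'e::real_normed_vector) atlas \<Rightarrow> 'a metric \<Rightarrow> ('b, 'f::real_normed_vector) atlas \<Rightarrow>
     ('a \<Rightarrow> 'b) \<Rightarrow> 'a \<Rightarrow> 'a tangent set" where
  "horizontal_space A g B F p =
     {v \<in> tangent_space A p. \<forall>u\<in>vertical_space A B F p. g p v u = 0}"

definition riemannian_submersion ::
    "('a::topological_space, 'e::real_normed_vector) atlas \<Rightarrow> 'a metric \<Rightarrow>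
     ('b::topological_space, 'f::real_normed_vector) atlas \<Rightarrow> 'b metric \<Rightarrow> ('a \<Rightarrow> 'b) \<Rightarrow> bool" where
  "riemannian_submersion A gM B gN F \<longleftrightarrow>
     smooth_map A B F \<and> surj F \<and>
     (\<forall>p. differential B F ` tangent_space A p = tangent_space B (F p)) \<and>
     (\<forall>p. \<forall>v\<in>horizontal_space A gM B F p.
        sqrt (gN (F p) (differential B F v) (differential B F v)) = sqrt (gM p v v))"

definition anti_invariant ::
    "('a, 'e::real_normed_vector) atlas \<Rightarrow> ('a \<Rightarrow> 'a tangent \<Rightarrow> 'a tangent) \<Rightarrow> 'a metric \<Rightarrow>
     ('b, 'f::real_normed_vector) atlas \<Rightarrow> ('a \<Rightarrow> 'b) \<Rightarrow> bool" where
  "anti_invariant A \<phi> g B F \<longleftrightarrow>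
     (\<forall>p. \<phi> p ` vertical_space A B F p \<subseteq> horizontal_space A g B F p)"

text \<open>The value \<open>(\<nabla>F\<^sub>*)(v, Y)\<close> at the point \<open>p\<close>, for a tangent vector \<open>v\<close> at \<open>p\<close> and a vector
  field \<open>Y\<close>; \<open>DM\<close> is the connection on the domain and \<open>DF\<close> the pullback connection.\<close>

definition second_fundamental_form ::
    "('b, 'f::real_normed_vector) atlas \<Rightarrow> ('a \<Rightarrow> 'b) \<Rightarrow> 'a connection \<Rightarrow>
     ('a \<Rightarrow> 'a tangent \<Rightarrow> ('a \<Rightarrow> 'b tangent) \<Rightarrow> 'b tangent) \<Rightarrow>
     'a \<Rightarrow> 'a tangent \<Rightarrow> 'a field \<Rightarrow> 'b tangent" where
  "second_fundamental_form B F DM DF p v Y =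
     DF p v (\<lambda>q. differential B F (Y q)) - differential B F (DM p v Y)"

definition totally_geodesic ::
    "('a, 'e::real_normed_vector) atlas \<Rightarrow> ('b, 'f::real_normed_vector) atlas \<Rightarrow> ('a \<Rightarrow> 'b) \<Rightarrow>
     'a connection \<Rightarrow> ('a \<Rightarrow> 'a tangent \<Rightarrow> ('a \<Rightarrow> 'b tangent) \<Rightarrow> 'b tangent) \<Rightarrow> bool" where
  "totally_geodesic A B F DM DF \<longleftrightarrow>
     (\<forall>p. \<forall>v\<in>tangent_space A p. \<forall>Y\<in>vector_fields A.
        second_fundamental_form B F DM DF p v Y = 0)"

end

theory Submission
  imports Defs
begin

text \<open>A vertical vector \<open>v\<close> with \<open>\<phi> v \<noteq> 0\<close> and the field \<open>\<xi>\<close> already detect that \<open>F\<close> is not totally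
  geodesic. On a Sasakian manifold \<open>\<nabla>\<^sub>v \<xi> = - \<phi> v\<close>. Since \<open>\<xi>\<close> is vertical, \<open>F\<^sub>* \<xi>\<close> is the zero section
  of the pullback bundle and its covariant derivative vanishes, so
  \<open>(\<nabla>F\<^sub>*)(v, \<xi>) = - F\<^sub>*(\<nabla>\<^sub>v \<xi>) = F\<^sub>*(\<phi> v)\<close>. Anti-invariance makes \<open>\<phi> v\<close> horizontal, and a Riemannian
  submersion is injective on horizontal vectors because it preserves their lengths. Hence
  \<open>F\<^sub>*(\<phi> v) \<noteq> 0\<close>.\<close>

lemma smooth_on_const:
  fixes c :: "'f::real_normed_vector"
  shows "smooth_on S (\<lambda>x. c)"
proof -
  have "Ck_on k S (\<lambda>x. c)" for k and c :: 'f
    by (induction k arbitrary: c) simp_all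
  then show ?thesis by (simp add: smooth_on_def)
qed

lemma smooth_fun_const: "smooth_fun A (\<lambda>x. c)"
  by (auto simp: smooth_fun_def comp_def smooth_on_const)

lemma zero_in_tangent_space: "0 \<in> tangent_space A p"
  by (simp add: tangent_space_def linear_on_subspace_def)

lemma tangent_space_scaleR:
  assumes "v \<in> tangent_space A p"
  shows "c *\<^sub>R v \<in> tangent_space A p"
  using assms
  by (auto simp: tangent_space_def linear_on_subspace_def scaleR_fun_def algebra_simps)

lemma tangent_const:
  assumes "v \<in> tangent_space A p"
  shows "v (\<lambda>x. c) = 0"
proof -
  have "v (\<lambda>q. 1 * 1) = v (\<lambda>q. 1) * 1 + 1 * v (\<lambda>q. 1)"
    using assms smooth_fun_const[of A 1] unfolding tangent_space_def by blast
  then have one: "v (\<lambda>q. 1) = 0" by simp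
  have "v (c *\<^sub>R (\<lambda>q. 1)) = c *\<^sub>R v (\<lambda>q. 1)"
    using assms smooth_fun_const[of A 1]
    unfolding tangent_space_def linear_on_subspace_def by blast
  then show ?thesis by (simp add: one scaleR_fun_def)
qed

lemma linear_on_subspace_zero:
  assumes "linear_on_subspace S f" "0 \<in> S"
  shows "f 0 = 0"
proof -
  have "f (0 + 0) = f 0 + f 0"
    using assms unfolding linear_on_subspace_def by blast
  then show ?thesis by simp
qed

lemma vector_field_tangent:
  assumes "X \<in> vector_fields A"
  shows "X p \<in> tangent_space A p"
  using assms by (simp add: vector_fields_def sections_along_def)

lemma connection_along_tangent:
  assumes "connection_along A B F D" "s \<in> sections_along A B F" "v \<in> tangent_space A p"
  shows "D p v s \<in> tangent_space B (F p)"
  using assms unfolding connection_along_def by blast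

lemma zero_section: "(\<lambda>q. 0) \<in> sections_along A B F"
  by (simp add: sections_along_def zero_in_tangent_space smooth_fun_const)

lemma connection_along_zero_section:
  assumes "connection_along A B F D" "v \<in> tangent_space A p"
  shows "D p v (\<lambda>q. 0) = 0"
proof -
  have "D p v (\<lambda>q. s q + t q) = D p v s + D p v t"
    if "s \<in> sections_along A B F" "t \<in> sections_along A B F" for s t
    using assms that unfolding connection_along_def by blast
  from this[OF zero_section zero_section] show ?thesis by simp
qed

lemma differential_minus: "differential B F (- v) = - differential B F v"
  by (auto simp: differential_def fun_eq_iff)

text \<open>Evaluating the formula for \<open>\<nabla>\<phi>\<close> on \<open>\<xi>\<close>, where \<open>\<phi> \<xi> = 0\<close>, gives \<open>\<phi> (\<nabla>\<^sub>v \<xi>) = v - \<eta> v \<xi>\<close>. Applying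
  \<open>\<phi>\<close> once more determines \<open>\<nabla>\<^sub>v \<xi>\<close> up to a multiple of \<open>\<xi>\<close>, and that multiple is 0 because \<open>\<xi>\<close> has
  constant length.\<close>

lemma sasakian_connection_xi:
  assumes sas: "sasakian_manifold A \<phi> \<xi> \<eta> g D" and v: "v \<in> tangent_space A p"
  shows "D p v \<xi> = - \<phi> p v"
proof -
  have met: "riemannian_metric A g" and lc: "levi_civita A g D"
    and ten: "tensor_field_1_1 A \<phi>" and xi: "\<xi> \<in> vector_fields A"
    and sq: "\<And>w. w \<in> tangent_space A p \<Longrightarrow> \<phi> p (\<phi> p w) = - w + \<eta> p w *\<^sub>R \<xi> p"
    and phi_xi: "\<And>q. \<phi> q (\<xi> q) = 0" and eta_xi: "\<And>q. \<eta> q (\<xi> q) = 1"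
    and eta: "\<And>q w. w \<in> tangent_space A q \<Longrightarrow> \<eta> q w = g q w (\<xi> q)"
    and cov: "\<And>Y. Y \<in> vector_fields A \<Longrightarrow> D p v (\<lambda>q. \<phi> q (Y q)) - \<phi> p (D p v Y)
              = g p v (Y p) *\<^sub>R \<xi> p - \<eta> p (Y p) *\<^sub>R v"
    using sas v unfolding sasakian_manifold_def riemannian_manifold_def by simp_all
  have con: "connection_along A A id D"
    using lc by (simp add: levi_civita_def)
  let ?w = "D p v \<xi>"
  have w: "?w \<in> tangent_space A p"
    using connection_along_tangent[OF con _ v] xi by (simp add: vector_fields_def)
  have xi_p: "\<xi> p \<in> tangent_space A p"
    using xi by (rule vector_field_tangent)
  have lin: "linear_on_subspace (tangent_space A p) (\<phi> p)"
    and phi_w: "\<phi> p ?w \<in> tangent_space A p"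
    using ten w by (auto simp: tensor_field_1_1_def)

  have "- \<phi> p ?w = \<eta> p v *\<^sub>R \<xi> p - v"
    using cov[OF xi] connection_along_zero_section[OF con v] by (simp add: phi_xi eta_xi eta[OF v])
  then have v_eq: "v = \<phi> p ?w + \<eta> p v *\<^sub>R \<xi> p"
    by (simp add: algebra_simps)
  have "\<phi> p (\<phi> p ?w + c *\<^sub>R \<xi> p) = \<phi> p (\<phi> p ?w) + c *\<^sub>R \<phi> p (\<xi> p)" for c
    using lin phi_w xi_p tangent_space_scaleR[OF xi_p]
    by (simp add: linear_on_subspace_def)
  then have "\<phi> p v = \<phi> p (\<phi> p ?w) + \<eta> p v *\<^sub>R \<phi> p (\<xi> p)"
    using v_eq by metis
  then have phi_v: "\<phi> p v = - ?w + \<eta> p ?w *\<^sub>R \<xi> p"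
    by (simp add: phi_xi sq[OF w])

  have "g q (\<xi> q) (\<xi> q) = 1" for q
    using eta[OF vector_field_tangent[OF xi]] by (simp add: eta_xi)
  moreover have "v (\<lambda>q. g q (\<xi> q) (\<xi> q)) = g p ?w (\<xi> p) + g p (\<xi> p) ?w"
    using lc xi v unfolding levi_civita_def by blast
  ultimately have "g p ?w (\<xi> p) + g p (\<xi> p) ?w = 0"
    using tangent_const[OF v] by simp
  moreover have "g p (\<xi> p) ?w = g p ?w (\<xi> p)"
    using met xi_p w unfolding riemannian_metric_def by blast
  ultimately have "\<eta> p ?w = 0"
    by (simp add: eta[OF w])
  then show ?thesis using phi_v by simp
qed

lemma riemannian_submersion_inj_horizontal:
  assumes gM: "riemannian_metric A gM" and gN: "riemannian_metric B gN"
    and F: "riemannian_submersion A gM B gN F"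
    and u: "u \<in> horizontal_space A gM B F p" and zero: "differential B F u = 0"
  shows "u = 0"
proof (rule ccontr)
  assume "u \<noteq> 0"
  then have pos: "gM p u u > 0"
    using gM u by (auto simp: riemannian_metric_def horizontal_space_def)
  have "gN (F p) 0 0 = 0"
    using gN zero_in_tangent_space[of B "F p"]
      linear_on_subspace_zero[of "tangent_space B (F p)" "gN (F p) 0"]
    unfolding riemannian_metric_def by blast
  moreover have "sqrt (gN (F p) 0 0) = sqrt (gM p u u)"
    using F u unfolding riemannian_submersion_def by (metis zero)
  ultimately show False using pos by simp
qed

lemma second_fundamental_form_vertical_xi:
  assumes sas: "sasakian_manifold A \<phi> \<xi> \<eta> g DM" and DF: "connection_along A B F DF"
    and xi: "\<And>q. \<xi> q \<in> vertical_space A B F q" and v: "v \<in> tangent_space A p"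
  shows "second_fundamental_form B F DM DF p v \<xi> = differential B F (\<phi> p v)"
proof -
  have "(\<lambda>q. differential B F (\<xi> q)) = (\<lambda>q. 0)"
    using xi by (simp add: vertical_space_def)
  then show ?thesis
    using connection_along_zero_section[OF DF v]
    by (simp add: second_fundamental_form_def sasakian_connection_xi[OF sas v] differential_minus)
qed

theorem theorem5:
  fixes A :: "('a::{t2_space, second_countable_topology}, 'e::real_normed_vector) atlas"
    and B :: "('b::{t2_space, second_countable_topology}, 'f::real_normed_vector) atlas"
    and F :: "'a \<Rightarrow> 'b"
  assumes "sasakian_manifold A \<phi> \<xi> \<eta> gM DM"
    and "riemannian_manifold B gN"
    and "levi_civita B gN DN"
    and "pullback_connection A B F DN DF"
    and "riemannian_submersion A gM B gN F"
    and "anti_invariant A \<phi> gM B F"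
    and "\<forall>p. \<xi> p \<in> vertical_space A B F p"
    and "\<exists>p. \<exists>v\<in>vertical_space A B F p. \<phi> p v \<noteq> 0"
  shows "\<not> totally_geodesic A B F DM DF"
proof
  assume geo: "totally_geodesic A B F DM DF"
  obtain p v where v: "v \<in> vertical_space A B F p" and nz: "\<phi> p v \<noteq> 0"
    using assms(8) by blast
  have tv: "v \<in> tangent_space A p"
    using v by (simp add: vertical_space_def)
  have gM: "riemannian_metric A gM" and xi: "\<xi> \<in> vector_fields A"
    using assms(1) by (simp_all add: sasakian_manifold_def riemannian_manifold_def)
  have gN: "riemannian_metric B gN"
    using assms(2) by (simp add: riemannian_manifold_def)
  have DF: "connection_along A B F DF"
    using assms(4) by (simp add: pullback_connection_def)
  have "differential B F (\<phi> p v) = second_fundamental_form B F DM DF p v \<xi>"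
    using second_fundamental_form_vertical_xi[OF assms(1) DF _ tv] assms(7) by simp
  also have "\<dots> = 0"
    using geo tv xi by (simp add: totally_geodesic_def)
  finally have "differential B F (\<phi> p v) = 0" .
  moreover have "\<phi> p v \<in> horizontal_space A gM B F p"
    using assms(6) v by (auto simp: anti_invariant_def)
  ultimately have "\<phi> p v = 0"
    using riemannian_submersion_inj_horizontal[OF gM gN assms(5)] by blast
  with nz show False by simp
qed

end
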